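(* Let $\Omega$ be a semigroup and let $(A,M,\{R_\alpha\}_{\alpha\in\Omega})$ be a relative Rota-Baxter family algebra over a field ${\bf k}$ of characteristic $0$. Then there is a bijection between the set of all equivalence classes of infinitesimal deformations of $(A,M,\{R_\alpha\}_{\alpha\in\Omega})$ and the second cohomology group $H^2_\mathrm{rRBf}(A,M,\{R_\alpha\}_{\alpha\in\Omega})$.
   Context: All vector spaces and linear maps are over a field ${\bf k}$ of characteristic $0$; $\Omega$ is a semigroup. Associative algebras are not assumed unital. Relative Rota-Baxter family algebra: a triple $(A,M,\{R_\alpha\}_{\alpha\in\Omega})$ of an associative algebra $A=(A,\mu)$, $\mu(a,b)=a\cdot b$, an $A$-bimodule $M=(M,l,r)$, $l(a,u)=a\cdot_M u$, $r(u,a)=u\cdot_M a$, and linear maps $R_\alpha:M\to A$ with $R_\alpha(u)\cdot R_\beta(v)=R_{\alpha\beta}(R_\alpha(u)\cdot_M v+u\cdot_M R_\beta(v))$ for all $u,v\in M$, $\alpha,\beta\in\Omega$. The same definition is used over a commutative base ring. A morphism $(\varphi,\psi)$ from $((A,\mu),(M,l,r),\{R_\alpha\})$ to $((A',\mu'),(M',l',r'),\{R'_\alpha\})$ is a pair of linear maps $\varphi:A\to A'$, $\psi:M\to M'$ with $\varphi(\mu(a,b))=\mu'(\varphi(a),\varphi(b))$, $\psi(l(a,u))=l'(\varphi(a),\psi(u))$, $\psi(r(u,a))=r'(\psi(u),\varphi(a))$ and $\varphi\circ R_\alpha=R'_\alpha\circ\psi$ for all $\alpha\in\Omega$. Cochain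 complex. $\mathcal{A}^{k,1}$ is the direct sum of all $(k+1)$-fold tensor products of copies of $A$ and $M$ with $A$ appearing $k$ times and $M$ once. $\mathrm{Hom}_\Omega(M^{\otimes n},A)$ ($n\geq1$) is the space of collections $\{\gamma_{\alpha_1,\ldots,\alpha_n}:M^{\otimes n}\to A\}_{\alpha_1,\ldots,\alpha_n\in\Omega}$ of linear maps. Write $C^n$ for $C^n_\mathrm{rRBf}(A,M,\{R_\alpha\}_{\alpha\in\Omega})$: $C^0=0$, $C^1=\mathrm{Hom}(A,A)\oplus\mathrm{Hom}(M,M)$, and $C^n=\mathrm{Hom}(A^{\otimes n},A)\oplus\mathrm{Hom}(\mathcal{A}^{n-1,1},M)\oplus\mathrm{Hom}_\Omega(M^{\otimes n-1},A)$ for $n\geq2$. The differential is $$\delta_\mathrm{rRBf}(f,g)=\big(\delta_\mathrm{Hoch}(f),\delta^f_\mathrm{Hoch}(g),h_R(f,g)\big)\ (n=1),\quad\delta_\mathrm{rRBf}(f,g,\gamma)=\big(\delta_\mathrm{Hoch}(f),\delta^f_\mathrm{Hoch}(g),\delta_R(\gamma)+h_R(f,g)\big)\ (n\geq2).$$ Here $\delta_\mathrm{Hoch}$ is the Hochschild differential of $A$ with coefficients in itself, $(\delta_\mathrm{Hoch}f)(a_1,\ldots,a_{n+1})=a_1\cdot f(a_2,\ldots,a_{n+1})+\sum_{i=1}^n(-1)^if(\ldots,a_i\cdot a_{i+1},\ldots)+(-1)^{n+1}f(a_1,\ldots,a_n)\cdot a_{n+1}$; for $a_1\otimes\cdots\otimes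 a_{n+1}\in\mathcal{A}^{n,1}$, \begin{align*} (\delta^f_\mathrm{Hoch}(g))(a_1,\ldots,a_{n+1})=~&(l+r)\big(a_1,(f+g)(a_2,\ldots,a_{n+1})\big)+\sum_{i=1}^n(-1)^ig\big(a_1,\ldots,(\mu+l+r)(a_i,a_{i+1}),\ldots,a_{n+1}\big)\\ &+(-1)^{n+1}(l+r)\big((f+g)(a_1,\ldots,a_n),a_{n+1}\big) \end{align*} (in each place the one of $\mu,l,r$, resp. $f,g$, that is defined on the given inputs is used); for $\gamma\in\mathrm{Hom}_\Omega(M^{\otimes n},A)$, \begin{align*} &(\delta_R(\gamma))_{\alpha_1,\ldots,\alpha_{n+1}}(u_1,\ldots,u_{n+1})=R_{\alpha_1}(u_1)\cdot\gamma_{\alpha_2,\ldots,\alpha_{n+1}}(u_2,\ldots,u_{n+1})-R_{\alpha_1\cdots\alpha_{n+1}}\big(u_1\cdot_M\gamma_{\alpha_2,\ldots,\alpha_{n+1}}(u_2,\ldots,u_{n+1})\big)\\ &+\sum_{i=1}^n(-1)^i\gamma_{\alpha_1,\ldots,\alpha_i\alpha_{i+1},\ldots,\alpha_{n+1}}\big(u_1,\ldots,u_{i-1},R_{\alpha_i}(u_i)\cdot_M u_{i+1}+u_i\cdot_M R_{\alpha_{i+1}}(u_{i+1}),\ldots,u_{n+1}\big)\\ &+(-1)^{n+1}\gamma_{\alpha_1,\ldots,\alpha_n}(u_1,\ldots,u_n)\cdot R_{\alpha_{n+1}}(u_{n+1})-(-1)^{n+1}R_{\alpha_1\cdots\alpha_{n+1}}\big(\gamma_{\alpha_1,\ldots,\alpha_n}(u_1,\ldots,u_n)\cdot_M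 u_{n+1}\big); \end{align*} and for $(f,g)\in\mathrm{Hom}(A^{\otimes n},A)\oplus\mathrm{Hom}(\mathcal{A}^{n-1,1},M)$, $$(h_R(f,g))_{\alpha_1,\ldots,\alpha_n}(u_1,\ldots,u_n)=(-1)^n\Big\{f\big(R_{\alpha_1}(u_1),\ldots,R_{\alpha_n}(u_n)\big)-\sum_{r=1}^nR_{\alpha_1\cdots\alpha_n}\big(g(R_{\alpha_1}(u_1),\ldots,u_r,\ldots,R_{\alpha_n}(u_n))\big)\Big\}.$$ This is a cochain complex; $H^n_\mathrm{rRBf}$ denotes its cohomology ($n$-cocycles modulo $n$-coboundaries). Infinitesimal deformations. An infinitesimal deformation of $(A,M,\{R_\alpha\}_{\alpha\in\Omega})$ is a quadruple $(\mu_t,l_t,r_t,\{(R_t)_\alpha\}_{\alpha\in\Omega})$ of truncated sums $\mu_t=\mu+t\mu_1$, $l_t=l+tl_1$, $r_t=r+tr_1$, $(R_t)_\alpha=R_\alpha+tR_{1,\alpha}$, with $\mu_1\in\mathrm{Hom}(A\otimes A,A)$, $l_1\in\mathrm{Hom}(A\otimes M,M)$, $r_1\in\mathrm{Hom}(M\otimes A,M)$, $R_{1,\alpha}\in\mathrm{Hom}(M,A)$, such that $\big((A[[t]]/(t^2),\mu_t),(M[[t]]/(t^2),l_t,r_t),\{(R_t)_\alpha\}_{\alpha\in\Omega}\big)$ is a relative Rota-Baxter family algebra over the ring ${\bf k}[[t]]/(t^2)$. Two infinitesimal deformations $(\mu_t,l_t,r_t,\{(R_t)_\alpha\})$ and $(\mu'_t,l'_t,r'_t,\{(R'_t)_\alpha\})$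 are equivalent if there are $\varphi_t=\mathrm{id}_A+t\varphi_1$, $\psi_t=\mathrm{id}_M+t\psi_1$ with $\varphi_1\in\mathrm{Hom}(A,A)$, $\psi_1\in\mathrm{Hom}(M,M)$ such that $(\varphi_t,\psi_t)$ is a morphism of relative Rota-Baxter family algebras over ${\bf k}[[t]]/(t^2)$ from the first to the second. *)

theory Defs
  imports
    "HOL-Library.Function_Algebras"
    "HOL-Library.Product_Plus"
    "HOL-Computational_Algebra.Formal_Power_Series"
begin

section \<open>Relative Rota-Baxter family algebras\<close>

text \<open>
  Everything is stated over a commutative base ring, as the definition is needed both over the
  ground field and over \<open>k[[t]]/(t\<^sup>2)\<close>. Over a field, \<^locale>\<open>module\<close> says the same as
  \<^locale>\<open>vector_space\<close>, and \<^locale>\<open>module_hom\<close> the same as linearity.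
\<close>

definition bilinear_map ::
  "('k::comm_ring_1 \<Rightarrow> 'a::ab_group_add \<Rightarrow> 'a) \<Rightarrow> ('k \<Rightarrow> 'b::ab_group_add \<Rightarrow> 'b) \<Rightarrow>
   ('k \<Rightarrow> 'c::ab_group_add \<Rightarrow> 'c) \<Rightarrow> ('a \<Rightarrow> 'b \<Rightarrow> 'c) \<Rightarrow> bool" where
  "bilinear_map s1 s2 s3 B \<longleftrightarrow>
     (\<forall>x. module_hom s2 s3 (\<lambda>y. B x y)) \<and> (\<forall>y. module_hom s1 s3 (\<lambda>x. B x y))"

locale rRBf_algebra = A: module sA + M: module sM
  for sA :: "'k::comm_ring_1 \<Rightarrow> 'a::ab_group_add \<Rightarrow> 'a"
    and sM :: "'k \<Rightarrow> 'm::ab_group_add \<Rightarrow> 'm" +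
  fixes mu :: "'a \<Rightarrow> 'a \<Rightarrow> 'a"
    and l :: "'a \<Rightarrow> 'm \<Rightarrow> 'm"
    and r :: "'m \<Rightarrow> 'a \<Rightarrow> 'm"
    and R :: "'w::semigroup_mult \<Rightarrow> 'm \<Rightarrow> 'a"
  assumes bilinear_mu: "bilinear_map sA sA sA mu"
    and bilinear_l: "bilinear_map sA sM sM l"
    and bilinear_r: "bilinear_map sM sA sM r"
    and linear_R: "module_hom sM sA (R \<alpha>)"
    and assoc: "mu (mu a b) c = mu a (mu b c)"
    and left_action: "l (mu a b) u = l a (l b u)"
    and bimodule: "r (l a u) b = l a (r u b)"
    and right_action: "r (r u a) b = r u (mu a b)"
    and rota_baxter: "mu (R \<alpha> u) (R \<beta> v) = R (\<alpha> * \<beta>) (l (R \<alpha> u) v + r u (R \<beta> v))"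

definition rRBf_morphism ::
  "('k::comm_ring_1 \<Rightarrow> 'a::ab_group_add \<Rightarrow> 'a) \<Rightarrow> ('k \<Rightarrow> 'm::ab_group_add \<Rightarrow> 'm) \<Rightarrow>
   ('a \<Rightarrow> 'a \<Rightarrow> 'a) \<times> ('a \<Rightarrow> 'm \<Rightarrow> 'm) \<times> ('m \<Rightarrow> 'a \<Rightarrow> 'm) \<times> ('w::semigroup_mult \<Rightarrow> 'm \<Rightarrow> 'a) \<Rightarrow>
   ('k \<Rightarrow> 'b::ab_group_add \<Rightarrow> 'b) \<Rightarrow> ('k \<Rightarrow> 'n::ab_group_add \<Rightarrow> 'n) \<Rightarrow>
   ('b \<Rightarrow> 'b \<Rightarrow> 'b) \<times> ('b \<Rightarrow> 'n \<Rightarrow> 'n) \<times> ('n \<Rightarrow> 'b \<Rightarrow> 'n) \<times> ('w \<Rightarrow> 'n \<Rightarrow> 'b) \<Rightarrow>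
   ('a \<Rightarrow> 'b) \<Rightarrow> ('m \<Rightarrow> 'n) \<Rightarrow> bool" where
  "rRBf_morphism sA sM = (\<lambda>(mu, l, r, R) sA' sM' (mu', l', r', R') \<phi> \<psi>.
     module_hom sA sA' \<phi> \<and> module_hom sM sM' \<psi> \<and>
     (\<forall>a b. \<phi> (mu a b) = mu' (\<phi> a) (\<phi> b)) \<and>
     (\<forall>a u. \<psi> (l a u) = l' (\<phi> a) (\<psi> u)) \<and>
     (\<forall>u a. \<psi> (r u a) = r' (\<psi> u) (\<phi> a)) \<and>
     (\<forall>\<alpha>. \<phi> \<circ> R \<alpha> = R' \<alpha> \<circ> \<psi>))"

section \<open>Cochains\<close>

text \<open>
  A linear map out of a tensor power is represented by the corresponding multilinear map, as a
  function on lists. Functions vanish on lists of the wrong shape, so that a cochain is determined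
  by its values on tensors, and cochains are added pointwise.
\<close>

definition multilinear_maps ::
  "('k::comm_ring_1 \<Rightarrow> 'a::ab_group_add \<Rightarrow> 'a) \<Rightarrow> ('k \<Rightarrow> 'b::ab_group_add \<Rightarrow> 'b) \<Rightarrow> nat \<Rightarrow>
   ('a list \<Rightarrow> 'b) set" where
  "multilinear_maps sA sB n =
     {f. (\<forall>xs. length xs \<noteq> n \<longrightarrow> f xs = 0) \<and>
         (\<forall>xs i. length xs = n \<longrightarrow> i < n \<longrightarrow> module_hom sA sB (\<lambda>x. f (xs[i := x])))}"

text \<open>
  The pure tensors of \<open>\<A>\<^bsup>k,1\<^esup>\<close> are words with \<open>k\<close> letters \<open>Inl a\<close> from \<open>A\<close> and one
  letter \<open>Inr u\<close> from \<open>M\<close>. A linear map on the direct sum is a family of maps, one for each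
  position of the letter from \<open>M\<close>, each of them multilinear.
\<close>

definition mixed_words :: "nat \<Rightarrow> ('a + 'm) list set" where
  "mixed_words k = {w. length w = Suc k \<and> length (filter (\<lambda>x. \<not> isl x) w) = 1}"

definition mixed_maps ::
  "('k::comm_ring_1 \<Rightarrow> 'a::ab_group_add \<Rightarrow> 'a) \<Rightarrow> ('k \<Rightarrow> 'm::ab_group_add \<Rightarrow> 'm) \<Rightarrow> nat \<Rightarrow>
   (('a + 'm) list \<Rightarrow> 'm) set" where
  "mixed_maps sA sM k =
     {g. (\<forall>w. w \<notin> mixed_words k \<longrightarrow> g w = 0) \<and>
         (\<forall>w \<in> mixed_words k. \<forall>i \<le> k.
            case w ! i of
              Inl _ \<Rightarrow> module_hom sA sM (\<lambda>a. g (w[i := Inl a]))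
            | Inr _ \<Rightarrow> module_hom sM sM (\<lambda>u. g (w[i := Inr u])))}"

definition family_maps ::
  "('k::comm_ring_1 \<Rightarrow> 'm::ab_group_add \<Rightarrow> 'm) \<Rightarrow> ('k \<Rightarrow> 'a::ab_group_add \<Rightarrow> 'a) \<Rightarrow> nat \<Rightarrow>
   ('w list \<Rightarrow> 'm list \<Rightarrow> 'a) set" where
  "family_maps sM sA n =
     {\<gamma>. \<forall>ws. if length ws = n then \<gamma> ws \<in> multilinear_maps sM sA n else \<gamma> ws = 0}"

text \<open>
  To have one type for all degrees, elements of \<open>C\<^sup>1\<close> carry a third component that is \<open>0\<close>.
\<close>

type_synonym ('a, 'm, 'w) cochain =
  "('a list \<Rightarrow> 'a) \<times> (('a + 'm) list \<Rightarrow> 'm) \<times> ('w list \<Rightarrow> 'm list \<Rightarrow> 'a)"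

definition cochains ::
  "('k::comm_ring_1 \<Rightarrow> 'a::ab_group_add \<Rightarrow> 'a) \<Rightarrow> ('k \<Rightarrow> 'm::ab_group_add \<Rightarrow> 'm) \<Rightarrow> nat \<Rightarrow>
   ('a, 'm, 'w::semigroup_mult) cochain set" where
  "cochains sA sM n =
     (if n = 0 then {0}
      else multilinear_maps sA sA n \<times> mixed_maps sA sM (n - 1) \<times>
           (if n = 1 then {0} else family_maps sM sA (n - 1)))"

section \<open>The differential\<close>

text \<open>
  Positions are counted from 1 in \<open>contract\<close>: it replaces the \<open>i\<close>-th and \<open>(i+1)\<close>-th
  entries, which are \<open>xs ! (i - 1)\<close> and \<open>xs ! i\<close>, by \<open>x\<close>.
\<close>

definition contract :: "nat \<Rightarrow> 'x \<Rightarrow> 'x list \<Rightarrow> 'x list" where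
  "contract i x xs = take (i - 1) xs @ x # drop (i + 1) xs"

definition sg_prod :: "'w::semigroup_mult list \<Rightarrow> 'w" where
  "sg_prod ws = foldl (*) (hd ws) (tl ws)"

definition delta_Hoch ::
  "('k::comm_ring_1 \<Rightarrow> 'a::ab_group_add \<Rightarrow> 'a) \<Rightarrow> ('a \<Rightarrow> 'a \<Rightarrow> 'a) \<Rightarrow>
   nat \<Rightarrow> ('a list \<Rightarrow> 'a) \<Rightarrow> 'a list \<Rightarrow> 'a" where
  "delta_Hoch sA mu n f = (\<lambda>xs.
     if length xs = n + 1 then
       mu (hd xs) (f (tl xs))
       + (\<Sum>i=1..n. sA ((-1) ^ i) (f (contract i (mu (xs ! (i - 1)) (xs ! i)) xs)))
       + sA ((-1) ^ (n + 1)) (mu (f (butlast xs)) (last xs))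
     else 0)"

text \<open>
  \<open>mixed_mult\<close> is \<open>\<mu> + l + r\<close> and \<open>mixed_eval f g\<close> is \<open>f + g\<close>. On words with exactly one
  letter from \<open>M\<close>, the last equation of \<open>mixed_mult\<close> is never used.
\<close>

fun mixed_mult ::
  "('a \<Rightarrow> 'a \<Rightarrow> 'a) \<Rightarrow> ('a \<Rightarrow> 'm \<Rightarrow> 'm) \<Rightarrow> ('m \<Rightarrow> 'a \<Rightarrow> 'm) \<Rightarrow> 'a + 'm \<Rightarrow> 'a + 'm \<Rightarrow> 'a + 'm::zero" where
  "mixed_mult mu l r (Inl a) (Inl b) = Inl (mu a b)"
| "mixed_mult mu l r (Inl a) (Inr u) = Inr (l a u)"
| "mixed_mult mu l r (Inr u) (Inl a) = Inr (r u a)"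
| "mixed_mult mu l r (Inr u) (Inr v) = Inr 0"

definition mixed_eval ::
  "('a list \<Rightarrow> 'a) \<Rightarrow> (('a + 'm) list \<Rightarrow> 'm) \<Rightarrow> ('a + 'm) list \<Rightarrow> 'a + 'm" where
  "mixed_eval f g w = (if \<forall>x \<in> set w. isl x then Inl (f (map projl w)) else Inr (g w))"

definition delta_mixed ::
  "('k::comm_ring_1 \<Rightarrow> 'm::ab_group_add \<Rightarrow> 'm) \<Rightarrow>
   ('a \<Rightarrow> 'a \<Rightarrow> 'a) \<Rightarrow> ('a \<Rightarrow> 'm \<Rightarrow> 'm) \<Rightarrow> ('m \<Rightarrow> 'a \<Rightarrow> 'm) \<Rightarrow>
   nat \<Rightarrow> ('a list \<Rightarrow> 'a) \<Rightarrow> (('a + 'm) list \<Rightarrow> 'm) \<Rightarrow> ('a + 'm) list \<Rightarrow> 'm" where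
  "delta_mixed sM mu l r n f g = (\<lambda>w.
     if w \<in> mixed_words n then
       projr (mixed_mult mu l r (hd w) (mixed_eval f g (tl w)))
       + (\<Sum>i=1..n. sM ((-1) ^ i) (g (contract i (mixed_mult mu l r (w ! (i - 1)) (w ! i)) w)))
       + sM ((-1) ^ (n + 1)) (projr (mixed_mult mu l r (mixed_eval f g (butlast w)) (last w)))
     else 0)"

definition delta_R ::
  "('k::comm_ring_1 \<Rightarrow> 'a::ab_group_add \<Rightarrow> 'a) \<Rightarrow>
   ('a \<Rightarrow> 'a \<Rightarrow> 'a) \<Rightarrow> ('a \<Rightarrow> 'm::ab_group_add \<Rightarrow> 'm) \<Rightarrow> ('m \<Rightarrow> 'a \<Rightarrow> 'm) \<Rightarrow>
   ('w::semigroup_mult \<Rightarrow> 'm \<Rightarrow> 'a) \<Rightarrow>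
   nat \<Rightarrow> ('w list \<Rightarrow> 'm list \<Rightarrow> 'a) \<Rightarrow> 'w list \<Rightarrow> 'm list \<Rightarrow> 'a" where
  "delta_R sA mu l r R n \<gamma> = (\<lambda>ws us.
     if length ws = n + 1 \<and> length us = n + 1 then
       mu (R (hd ws) (hd us)) (\<gamma> (tl ws) (tl us))
       - R (sg_prod ws) (r (hd us) (\<gamma> (tl ws) (tl us)))
       + (\<Sum>i=1..n. sA ((-1) ^ i)
           (\<gamma> (contract i (ws ! (i - 1) * ws ! i) ws)
              (contract i (l (R (ws ! (i - 1)) (us ! (i - 1))) (us ! i)
                           + r (us ! (i - 1)) (R (ws ! i) (us ! i))) us)))
       + sA ((-1) ^ (n + 1)) (mu (\<gamma> (butlast ws) (butlast us)) (R (last ws) (last us)))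
       - sA ((-1) ^ (n + 1)) (R (sg_prod ws) (l (\<gamma> (butlast ws) (butlast us)) (last us)))
     else 0)"

definition h_R ::
  "('k::comm_ring_1 \<Rightarrow> 'a::ab_group_add \<Rightarrow> 'a) \<Rightarrow> ('w::semigroup_mult \<Rightarrow> 'm \<Rightarrow> 'a) \<Rightarrow>
   nat \<Rightarrow> ('a list \<Rightarrow> 'a) \<Rightarrow> (('a + 'm) list \<Rightarrow> 'm) \<Rightarrow> 'w list \<Rightarrow> 'm list \<Rightarrow> 'a" where
  "h_R sA R n f g = (\<lambda>ws us.
     if length ws = n \<and> length us = n then
       sA ((-1) ^ n)
         (f (map2 R ws us)
          - (\<Sum>j<n. R (sg_prod ws) (g ((map Inl (map2 R ws us))[j := Inr (us ! j)]))))
     else 0)"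

definition differential ::
  "('k::comm_ring_1 \<Rightarrow> 'a::ab_group_add \<Rightarrow> 'a) \<Rightarrow> ('k \<Rightarrow> 'm::ab_group_add \<Rightarrow> 'm) \<Rightarrow>
   ('a \<Rightarrow> 'a \<Rightarrow> 'a) \<Rightarrow> ('a \<Rightarrow> 'm \<Rightarrow> 'm) \<Rightarrow> ('m \<Rightarrow> 'a \<Rightarrow> 'm) \<Rightarrow>
   ('w::semigroup_mult \<Rightarrow> 'm \<Rightarrow> 'a) \<Rightarrow>
   nat \<Rightarrow> ('a, 'm, 'w) cochain \<Rightarrow> ('a, 'm, 'w) cochain" where
  "differential sA sM mu l r R n = (\<lambda>(f, g, \<gamma>).
     if n = 0 then 0
     else (delta_Hoch sA mu n f, delta_mixed sM mu l r n f g,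
           (if n = 1 then h_R sA R n f g
            else delta_R sA mu l r R (n - 1) \<gamma> + h_R sA R n f g)))"

section \<open>Cohomology\<close>

definition cocycles ::
  "('k::comm_ring_1 \<Rightarrow> 'a::ab_group_add \<Rightarrow> 'a) \<Rightarrow> ('k \<Rightarrow> 'm::ab_group_add \<Rightarrow> 'm) \<Rightarrow>
   ('a \<Rightarrow> 'a \<Rightarrow> 'a) \<Rightarrow> ('a \<Rightarrow> 'm \<Rightarrow> 'm) \<Rightarrow> ('m \<Rightarrow> 'a \<Rightarrow> 'm) \<Rightarrow>
   ('w::semigroup_mult \<Rightarrow> 'm \<Rightarrow> 'a) \<Rightarrow> nat \<Rightarrow> ('a, 'm, 'w) cochain set" where
  "cocycles sA sM mu l r R n = {c \<in> cochains sA sM n. differential sA sM mu l r R n c = 0}"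

definition coboundaries ::
  "('k::comm_ring_1 \<Rightarrow> 'a::ab_group_add \<Rightarrow> 'a) \<Rightarrow> ('k \<Rightarrow> 'm::ab_group_add \<Rightarrow> 'm) \<Rightarrow>
   ('a \<Rightarrow> 'a \<Rightarrow> 'a) \<Rightarrow> ('a \<Rightarrow> 'm \<Rightarrow> 'm) \<Rightarrow> ('m \<Rightarrow> 'a \<Rightarrow> 'm) \<Rightarrow>
   ('w::semigroup_mult \<Rightarrow> 'm \<Rightarrow> 'a) \<Rightarrow> nat \<Rightarrow> ('a, 'm, 'w) cochain set" where
  "coboundaries sA sM mu l r R n =
     (if n = 0 then {0} else differential sA sM mu l r R (n - 1) ` cochains sA sM (n - 1))"

definition cohomology ::
  "('k::comm_ring_1 \<Rightarrow> 'a::ab_group_add \<Rightarrow> 'a) \<Rightarrow> ('k \<Rightarrow> 'm::ab_group_add \<Rightarrow> 'm) \<Rightarrow>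
   ('a \<Rightarrow> 'a \<Rightarrow> 'a) \<Rightarrow> ('a \<Rightarrow> 'm \<Rightarrow> 'm) \<Rightarrow> ('m \<Rightarrow> 'a \<Rightarrow> 'm) \<Rightarrow>
   ('w::semigroup_mult \<Rightarrow> 'm \<Rightarrow> 'a) \<Rightarrow> nat \<Rightarrow> ('a, 'm, 'w) cochain set set" where
  "cohomology sA sM mu l r R n =
     cocycles sA sM mu l r R n //
       {(c, d). c \<in> cocycles sA sM mu l r R n \<and> d \<in> cocycles sA sM mu l r R n \<and>
                c - d \<in> coboundaries sA sM mu l r R n}"

section \<open>Power series modulo \<open>t\<^sup>2\<close>\<close>

text \<open>
  \<open>'a trunc\<close> is \<open>V[[t]]/(t\<^sup>2)\<close> for \<open>V = 'a\<close>; the class of a power series is given by its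
  representative \<open>Tr x y = x + t y\<close>. The type is used for the base ring as well as for \<open>A\<close>
  and \<open>M\<close>.
\<close>

datatype 'a trunc = Tr (tr0: 'a) (tr1: 'a)

instantiation trunc :: (ab_group_add) ab_group_add
begin

definition "0 = Tr 0 0"
definition "x + y = Tr (tr0 x + tr0 y) (tr1 x + tr1 y)"
definition "x - y = Tr (tr0 x - tr0 y) (tr1 x - tr1 y)"
definition "- x = Tr (- tr0 x) (- tr1 x)"

instance
  by standard
    (simp_all add: zero_trunc_def plus_trunc_def minus_trunc_def uminus_trunc_def algebra_simps)

end

instantiation trunc :: (comm_ring_1) comm_ring_1
begin

definition "1 = Tr 1 0"
definition "x * y = Tr (tr0 x * tr0 y) (tr0 x * tr1 y + tr1 x * tr0 y)"

instance
  by standard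
    (simp_all add: zero_trunc_def plus_trunc_def one_trunc_def times_trunc_def algebra_simps)

end

definition trunc_of_fps :: "'a::zero fps \<Rightarrow> 'a trunc" where
  "trunc_of_fps f = Tr (fps_nth f 0) (fps_nth f 1)"

text \<open>\<open>k trunc\<close> is the quotient ring of \<open>k[[t]]\<close> by the ideal \<open>(t\<^sup>2)\<close>:\<close>

lemma trunc_of_fps_ring_hom:
  fixes f g :: "'k::comm_ring_1 fps"
  shows "trunc_of_fps (f + g) = trunc_of_fps f + trunc_of_fps g"
    and "trunc_of_fps (f * g) = trunc_of_fps f * trunc_of_fps g"
    and "trunc_of_fps (1 :: 'k fps) = 1"
  by (simp_all add: trunc_of_fps_def plus_trunc_def times_trunc_def one_trunc_def
        fps_mult_nth_1 algebra_simps)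

lemma surj_trunc_of_fps: "surj (trunc_of_fps :: 'k::comm_ring_1 fps \<Rightarrow> 'k trunc)"
proof (rule surjI)
  show "trunc_of_fps (Abs_fps (\<lambda>n. if n = 0 then tr0 x else tr1 x)) = x" for x :: "'k trunc"
    by (simp add: trunc_of_fps_def)
qed

lemma trunc_of_fps_eq_0_iff:
  fixes f :: "'k::comm_ring_1 fps"
  shows "trunc_of_fps f = 0 \<longleftrightarrow> fps_X ^ 2 dvd f"
proof
  assume "trunc_of_fps f = 0"
  then have "fps_nth f 0 = 0" "fps_nth f 1 = 0"
    by (simp_all add: trunc_of_fps_def zero_trunc_def)
  then have "fps_nth f n = 0" if "n < 2" for n
    using that by (auto simp: less_2_cases_iff)
  then have "f = fps_X ^ 2 * fps_shift 2 f"
    by (simp add: fps_eq_iff fps_X_power_mult_nth not_less del: add_2_eq_Suc')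
  then show "fps_X ^ 2 dvd f"
    by (rule dvdI)
next
  assume "fps_X ^ 2 dvd f"
  then show "trunc_of_fps f = 0"
    by (auto elim!: dvdE simp: trunc_of_fps_def zero_trunc_def fps_X_power_mult_nth)
qed

definition trunc_scale ::
  "('k::comm_ring_1 \<Rightarrow> 'a::ab_group_add \<Rightarrow> 'a) \<Rightarrow> 'k trunc \<Rightarrow> 'a trunc \<Rightarrow> 'a trunc" where
  "trunc_scale s c x = Tr (s (tr0 c) (tr0 x)) (s (tr0 c) (tr1 x) + s (tr1 c) (tr0 x))"

lemma module_trunc_scale:
  assumes "module s"
  shows "module (trunc_scale s)"
proof -
  interpret module s by fact
  show ?thesis
    by standard
      (simp_all add: trunc_scale_def plus_trunc_def times_trunc_def one_trunc_def algebra_simps)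
qed

text \<open>
  \<open>f + t f1\<close> and \<open>B + t B1\<close> as maps on power series modulo \<open>t\<^sup>2\<close>: the coefficient maps are
  extended \<open>k[[t]]/(t\<^sup>2)\<close>-linearly (bilinearly), and \<open>t\<^sup>2 = 0\<close>.
\<close>

definition trunc_lin ::
  "('a \<Rightarrow> 'b::ab_group_add) \<Rightarrow> ('a \<Rightarrow> 'b) \<Rightarrow> 'a trunc \<Rightarrow> 'b trunc" where
  "trunc_lin f f1 x = Tr (f (tr0 x)) (f (tr1 x) + f1 (tr0 x))"

definition trunc_bilin ::
  "('a \<Rightarrow> 'b \<Rightarrow> 'c::ab_group_add) \<Rightarrow> ('a \<Rightarrow> 'b \<Rightarrow> 'c) \<Rightarrow> 'a trunc \<Rightarrow> 'b trunc \<Rightarrow> 'c trunc" where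
  "trunc_bilin B B1 x y =
     Tr (B (tr0 x) (tr0 y)) (B (tr0 x) (tr1 y) + B (tr1 x) (tr0 y) + B1 (tr0 x) (tr0 y))"

section \<open>Infinitesimal deformations\<close>

type_synonym ('a, 'm, 'w) trunc_structure =
  "('a trunc \<Rightarrow> 'a trunc \<Rightarrow> 'a trunc) \<times> ('a trunc \<Rightarrow> 'm trunc \<Rightarrow> 'm trunc) \<times>
   ('m trunc \<Rightarrow> 'a trunc \<Rightarrow> 'm trunc) \<times> ('w \<Rightarrow> 'm trunc \<Rightarrow> 'a trunc)"

definition infinitesimal_deformations ::
  "('k::comm_ring_1 \<Rightarrow> 'a::ab_group_add \<Rightarrow> 'a) \<Rightarrow> ('k \<Rightarrow> 'm::ab_group_add \<Rightarrow> 'm) \<Rightarrow>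
   ('a \<Rightarrow> 'a \<Rightarrow> 'a) \<Rightarrow> ('a \<Rightarrow> 'm \<Rightarrow> 'm) \<Rightarrow> ('m \<Rightarrow> 'a \<Rightarrow> 'm) \<Rightarrow>
   ('w::semigroup_mult \<Rightarrow> 'm \<Rightarrow> 'a) \<Rightarrow> ('a, 'm, 'w) trunc_structure set" where
  "infinitesimal_deformations sA sM mu l r R =
     {(mu_t, l_t, r_t, R_t).
        (\<exists>mu1 l1 r1 R1.
           bilinear_map sA sA sA mu1 \<and> bilinear_map sA sM sM l1 \<and> bilinear_map sM sA sM r1 \<and>
           (\<forall>\<alpha>. module_hom sM sA (R1 \<alpha>)) \<and>
           mu_t = trunc_bilin mu mu1 \<and> l_t = trunc_bilin l l1 \<and> r_t = trunc_bilin r r1 \<and>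
           R_t = (\<lambda>\<alpha>. trunc_lin (R \<alpha>) (R1 \<alpha>))) \<and>
        rRBf_algebra (trunc_scale sA) (trunc_scale sM) mu_t l_t r_t R_t}"

definition deformation_equiv ::
  "('k::comm_ring_1 \<Rightarrow> 'a::ab_group_add \<Rightarrow> 'a) \<Rightarrow> ('k \<Rightarrow> 'm::ab_group_add \<Rightarrow> 'm) \<Rightarrow>
   ('a \<Rightarrow> 'a \<Rightarrow> 'a) \<Rightarrow> ('a \<Rightarrow> 'm \<Rightarrow> 'm) \<Rightarrow> ('m \<Rightarrow> 'a \<Rightarrow> 'm) \<Rightarrow>
   ('w::semigroup_mult \<Rightarrow> 'm \<Rightarrow> 'a) \<Rightarrow>
   (('a, 'm, 'w) trunc_structure \<times> ('a, 'm, 'w) trunc_structure) set" where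
  "deformation_equiv sA sM mu l r R =
     {(D, D'). D \<in> infinitesimal_deformations sA sM mu l r R \<and>
               D' \<in> infinitesimal_deformations sA sM mu l r R \<and>
               (\<exists>\<phi>1 \<psi>1. module_hom sA sA \<phi>1 \<and> module_hom sM sM \<psi>1 \<and>
                  rRBf_morphism (trunc_scale sA) (trunc_scale sM) D
                    (trunc_scale sA) (trunc_scale sM) D'
                    (trunc_lin id \<phi>1) (trunc_lin id \<psi>1))}"

lemma equiv_deformation_equiv:
  fixes sA :: "'k::comm_ring_1 \<Rightarrow> 'a::ab_group_add \<Rightarrow> 'a"
    and sM :: "'k \<Rightarrow> 'm::ab_group_add \<Rightarrow> 'm"
    and R :: "'w::semigroup_mult \<Rightarrow> 'm \<Rightarrow> 'a"
  assumes "rRBf_algebra sA sM mu l r R"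
  shows "equiv (infinitesimal_deformations sA sM mu l r R) (deformation_equiv sA sM mu l r R)"
    (is "equiv ?D ?E")
proof -
  interpret rRBf_algebra sA sM mu l r R by fact
  have hom_id: "module_hom s s (\<lambda>x. x)" "module_hom s s (\<lambda>x. 0)" if "module s" for s :: "'k \<Rightarrow> 'x::ab_group_add \<Rightarrow> 'x"
    using that by (auto simp: module_hom_iff module.scale_zero_right)
  have lin_inv: "trunc_lin id f1 (trunc_lin id (\<lambda>x. - f1 x) x) = x"
      "trunc_lin id (\<lambda>x. - f1 x) (trunc_lin id f1 x) = x"
    for f1 :: "'x::ab_group_add \<Rightarrow> 'x" and x by (auto simp: trunc_lin_def)
  have eq_inv: "trunc_lin id (\<lambda>x. - f1 x) x = y \<longleftrightarrow> x = trunc_lin id f1 y"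
    for f1 :: "'x::ab_group_add \<Rightarrow> 'x" and x y by (metis lin_inv)
  have lin_comp: "trunc_lin id f1 (trunc_lin id g1 x) = trunc_lin id (\<lambda>x. f1 x + g1 x) x"
    for f1 g1 :: "'x::ab_group_add \<Rightarrow> 'x" and x by (auto simp: trunc_lin_def algebra_simps)
  have hom_lin: "module_hom (trunc_scale s) (trunc_scale s) (trunc_lin id f1)"
    if "module_hom s s f1" for s :: "'k \<Rightarrow> 'x::ab_group_add \<Rightarrow> 'x" and f1
    using that module_trunc_scale[of s]
    by (auto simp: module_hom_iff trunc_scale_def trunc_lin_def plus_trunc_def module.scale_right_distrib)
  have lin0: "trunc_lin id (\<lambda>_. 0) = (\<lambda>x :: 'x::ab_group_add trunc. x)"
    by (auto simp: trunc_lin_def fun_eq_iff)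
  have "refl_on ?D ?E"
  proof (rule refl_onI)
    fix D assume "D \<in> ?D"
    moreover have "rRBf_morphism (trunc_scale sA) (trunc_scale sM) D (trunc_scale sA) (trunc_scale sM) D
        (trunc_lin id (\<lambda>_. 0)) (trunc_lin id (\<lambda>_. 0))"
      using hom_lin[OF hom_id(2)[OF A.module_axioms]] hom_lin[OF hom_id(2)[OF M.module_axioms]]
      by (cases D) (auto simp: rRBf_morphism_def lin0 fun_eq_iff)
    ultimately show "(D, D) \<in> ?E"
      using hom_id(2)[OF A.module_axioms] hom_id(2)[OF M.module_axioms]
      by (auto simp: deformation_equiv_def)
  qed
  moreover have "sym ?E"
  proof (rule symI)
    fix D D' assume "(D, D') \<in> ?E"
    then obtain p q where *: "D \<in> ?D" "D' \<in> ?D" "module_hom sA sA p" "module_hom sM sM q"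
      "rRBf_morphism (trunc_scale sA) (trunc_scale sM) D (trunc_scale sA) (trunc_scale sM) D'
        (trunc_lin id p) (trunc_lin id q)"
      by (auto simp: deformation_equiv_def)
    have pq: "module_hom sA sA (\<lambda>x. - p x)" "module_hom sM sM (\<lambda>x. - q x)"
      using * by (auto simp: module_hom_iff module.scale_minus_right)
    have "rRBf_morphism (trunc_scale sA) (trunc_scale sM) D' (trunc_scale sA) (trunc_scale sM) D
        (trunc_lin id (\<lambda>x. - p x)) (trunc_lin id (\<lambda>x. - q x))"
      using *(5) hom_lin[OF pq(1)] hom_lin[OF pq(2)]
      by (cases D; cases D')
        (simp add: rRBf_morphism_def fun_eq_iff eq_inv lin_inv)
    then show "(D', D) \<in> ?E" using * pq by (auto simp: deformation_equiv_def)
  qed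
  moreover have "trans ?E"
  proof (rule transI)
    fix D D' D'' assume "(D, D') \<in> ?E" "(D', D'') \<in> ?E"
    then obtain p q p' q' where *: "D \<in> ?D" "D' \<in> ?D" "D'' \<in> ?D" "module_hom sA sA p" "module_hom sM sM q" "module_hom sA sA p'" "module_hom sM sM q'"
      "rRBf_morphism (trunc_scale sA) (trunc_scale sM) D (trunc_scale sA) (trunc_scale sM) D'
        (trunc_lin id p) (trunc_lin id q)"
      "rRBf_morphism (trunc_scale sA) (trunc_scale sM) D' (trunc_scale sA) (trunc_scale sM) D''
        (trunc_lin id p') (trunc_lin id q')"
      by (auto simp: deformation_equiv_def)
    have pq: "module_hom sA sA (\<lambda>x. p' x + p x)" "module_hom sM sM (\<lambda>x. q' x + q x)"
      using * by (auto simp: module_hom_iff module.scale_right_distrib)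
    have "rRBf_morphism (trunc_scale sA) (trunc_scale sM) D (trunc_scale sA) (trunc_scale sM) D''
        (trunc_lin id (\<lambda>x. p' x + p x)) (trunc_lin id (\<lambda>x. q' x + q x))"
      using *(8,9) hom_lin[OF pq(1)] hom_lin[OF pq(2)]
      unfolding rRBf_morphism_def
      by (cases D; cases D'; cases D'') (simp add: fun_eq_iff lin_comp[symmetric])
    then show "(D, D'') \<in> ?E" using * pq by (auto simp: deformation_equiv_def)
  qed
  moreover have "?E \<subseteq> ?D \<times> ?D" by (auto simp: deformation_equiv_def)
  ultimately show ?thesis by (auto simp: equiv_def)
qed

end

theory Submission
  imports Defs
begin

text \<open>
  Sending a 2-cochain \<open>(f, g, \<gamma>)\<close> to the structure with first-order terms \<open>\<mu>\<^sub>1 = f\<close>,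
  \<open>l\<^sub>1 + r\<^sub>1 = g\<close> and \<open>R\<^sub>1 = \<gamma>\<close> is injective. Modulo \<open>t\<^sup>2\<close>, the axioms of a relative
  Rota-Baxter family algebra reduce to their coefficients of \<open>t\<close>, which are exactly the components
  of \<open>\<delta>(f, g, \<gamma>) = 0\<close>. Likewise, \<open>(id + t \<phi>, id + t \<psi>)\<close> is a morphism exactly if the difference
  of the two cocycles is \<open>\<delta>(\<phi>, \<psi>)\<close>. So the bijection between cocycles and deformations carries one
  relation to the other and descends to the quotients; that these are equivalence relations plays
  no role.
\<close>

section \<open>Induced bijections of quotient sets\<close>

text \<open>\<open>G\<close> carries the class of \<open>x\<close> onto the class of
  \<open>G x\<close>: as \<open>E'\<close> lies in \<open>Y \<times> Y\<close>, everything related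
  to \<open>G x\<close> lifts to \<open>X\<close>, where \<open>iff\<close> applies. So the map on
  classes is the image map.\<close>

lemma bij_betw_quotient:
  assumes bij: "bij_betw G X Y"
    and E: "E \<subseteq> X \<times> X" and E': "E' \<subseteq> Y \<times> Y"
    and iff: "\<And>x y. x \<in> X \<Longrightarrow> y \<in> X \<Longrightarrow> (x, y) \<in> E \<longleftrightarrow> (G x, G y) \<in> E'"
  shows "bij_betw ((`) G) (X // E) (Y // E')"
proof -
  have inj: "inj_on G X" and im: "G ` X = Y"
    using bij by (auto simp: bij_betw_def)
  have img: "G ` (E `` {x}) = E' `` {G x}" if "x \<in> X" for x
  proof
    show "G ` (E `` {x}) \<subseteq> E' `` {G x}"
      using E iff that by auto
    show "E' `` {G x} \<subseteq> G ` (E `` {x})"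
    proof
      fix z assume z: "z \<in> E' `` {G x}"
      then obtain y where "y \<in> X" "z = G y"
        using E' im by auto
      with z iff that show "z \<in> G ` (E `` {x})"
        by auto
    qed
  qed
  \<comment> \<open>Taking images under \<open>G\<close> is injective on subsets of
    \<open>X\<close>, and \<open>E\<close> keeps the classes inside \<open>X\<close>.\<close>
  have "X // E \<subseteq> Pow X"
    using E by (auto simp: quotient_def)
  then have "inj_on ((`) G) (X // E)"
    by (metis inj inj_on_image_Pow inj_on_subset)
  moreover have "(`) G ` (X // E) = Y // E'"
    using im by (auto simp: quotient_def img image_iff)
  ultimately show ?thesis
    by (simp add: bij_betw_def)
qed

section \<open>Maps modulo \<open>t\<^sup>2\<close>\<close>

lemma bilinear_mapD:
  assumes "bilinear_map s1 s2 s3 B"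
  shows "B (x + x') y = B x y + B x' y"
    and "B x (y + y') = B x y + B x y'"
    and "B (s1 c x) y = s3 c (B x y)"
    and "B x (s2 c y) = s3 c (B x y)"
    and "B 0 y = 0"
    and "B x 0 = 0"
proof -
  have right: "module_hom s2 s3 (B x)" for x
    using assms by (simp add: bilinear_map_def)
  have left: "module_hom s1 s3 (\<lambda>x. B x y)" for y
    using assms by (simp add: bilinear_map_def)
  show "B (x + x') y = B x y + B x' y" "B (s1 c x) y = s3 c (B x y)" "B 0 y = 0"
    by (rule module_hom.add[OF left] module_hom.scale[OF left] module_hom.zero[OF left])+
  show "B x (y + y') = B x y + B x y'" "B x (s2 c y) = s3 c (B x y)" "B x 0 = 0"
    by (rule module_hom.add[OF right] module_hom.scale[OF right] module_hom.zero[OF right])+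
qed

lemma bilinear_trunc_bilin:
  assumes "module s1" "module s2" "module s3"
    and "bilinear_map s1 s2 s3 B" "bilinear_map s1 s2 s3 B1"
  shows "bilinear_map (trunc_scale s1) (trunc_scale s2) (trunc_scale s3) (trunc_bilin B B1)"
  unfolding bilinear_map_def module_hom_iff
  using assms(1-3)
  by (simp add: module_trunc_scale trunc_bilin_def trunc_scale_def plus_trunc_def
      bilinear_mapD[OF assms(4)] bilinear_mapD[OF assms(5)] module.scale_right_distrib
      algebra_simps)

lemma module_hom_trunc_lin:
  assumes "module_hom s s' f" "module_hom s s' f1"
  shows "module_hom (trunc_scale s) (trunc_scale s') (trunc_lin f f1)"
  using assms
  by (simp add: module_hom_iff module_trunc_scale trunc_lin_def trunc_scale_def plus_trunc_def
      module.scale_right_distrib algebra_simps)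

text \<open>This and the next two rules say that a structure determines its first-order terms. They
  give injectivity of \<open>deformation_of_cochain\<close> and resolve the existential quantifiers
  in \<open>infinitesimal_deformations\<close>.\<close>

lemma trunc_bilin_eq_iff [simp]:
  "trunc_bilin B B1 = trunc_bilin B B1' \<longleftrightarrow> B1 = B1'"
proof
  assume eq: "trunc_bilin B B1 = trunc_bilin B B1'"
  show "B1 = B1'"
  proof (intro ext)
    fix x y
    \<comment> \<open>The argument types carry no zero, so the t-parts are \<open>undefined\<close>;
      their contributions are the same on both sides and cancel.\<close>
    show "B1 x y = B1' x y"
      using fun_cong[OF fun_cong[OF eq], of "Tr x undefined" "Tr y undefined"]
      by (simp add: trunc_bilin_def)
  qed
qed simp

lemma trunc_lin_eq_iff [simp]: "trunc_lin f f1 = trunc_lin f f1' \<longleftrightarrow> f1 = f1'"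
proof
  assume eq: "trunc_lin f f1 = trunc_lin f f1'"
  show "f1 = f1'"
  proof
    fix x
    show "f1 x = f1' x"
      using fun_cong[OF eq, of "Tr x undefined"] by (simp add: trunc_lin_def)
  qed
qed simp

lemma trunc_lin_family_eq_iff [simp]:
  "(\<lambda>\<alpha>. trunc_lin (F \<alpha>) (F1 \<alpha>)) = (\<lambda>\<alpha>. trunc_lin (F \<alpha>) (F1' \<alpha>)) \<longleftrightarrow> F1 = F1'"
  \<comment> \<open>Only the two families are compared pointwise; the equations between
    \<open>trunc_lin\<close> maps stay intact for \<open>trunc_lin_eq_iff\<close>.\<close>
  unfolding fun_eq_iff[of "\<lambda>\<alpha>. trunc_lin (F \<alpha>) (F1 \<alpha>)"] fun_eq_iff[of F1] by simp

section \<open>Cochains of low degree\<close>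

lemma length_1_iff: "length xs = Suc 0 \<longleftrightarrow> (\<exists>a. xs = [a])"
  by (auto simp: length_Suc_conv)

lemma length_2_iff: "length xs = Suc (Suc 0) \<longleftrightarrow> (\<exists>a b. xs = [a, b])"
  by (auto simp: length_Suc_conv)

lemma length_3_iff: "length xs = Suc (Suc (Suc 0)) \<longleftrightarrow> (\<exists>a b c. xs = [a, b, c])"
  by (auto simp: length_Suc_conv)

lemma all_length_1: "(\<forall>xs. length xs = Suc 0 \<longrightarrow> P xs) \<longleftrightarrow> (\<forall>a. P [a])"
  by (auto simp: length_1_iff)

lemma all_length_2: "(\<forall>xs. length xs = Suc (Suc 0) \<longrightarrow> P xs) \<longleftrightarrow> (\<forall>a b. P [a, b])"
  by (auto simp: length_2_iff)

section \<open>Cochain equations tested on pure tensors\<close>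

text \<open>Cochains and their differentials vanish on lists of the wrong shape, so the assumption
  holds for them and an equation of cochains becomes identities between elements. The variants treat
  three arguments, families and mixed words.\<close>

lemma eq_iff_length_2:
  assumes "\<And>xs. length xs \<noteq> Suc (Suc 0) \<Longrightarrow> F xs = G xs"
  shows "F = G \<longleftrightarrow> (\<forall>a b. F [a, b] = G [a, b])"
  using assms by (metis ext length_2_iff)

lemma eq_iff_length_3:
  assumes "\<And>xs. length xs \<noteq> Suc (Suc (Suc 0)) \<Longrightarrow> F xs = G xs"
  shows "F = G \<longleftrightarrow> (\<forall>a b c. F [a, b, c] = G [a, b, c])"
  using assms by (metis ext length_3_iff)

lemma eq_iff_family_1:
  assumes "\<And>ws us. length ws \<noteq> Suc 0 \<or> length us \<noteq> Suc 0 \<Longrightarrow> F ws us = G ws us"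
  shows "F = G \<longleftrightarrow> (\<forall>\<alpha> u. F [\<alpha>] [u] = G [\<alpha>] [u])"
  using assms by (metis ext length_1_iff)

lemma eq_iff_family_2:
  assumes "\<And>ws us. length ws \<noteq> Suc (Suc 0) \<or> length us \<noteq> Suc (Suc 0) \<Longrightarrow> F ws us = G ws us"
  shows "F = G \<longleftrightarrow> (\<forall>\<alpha> \<beta> u v. F [\<alpha>, \<beta>] [u, v] = G [\<alpha>, \<beta>] [u, v])"
  using assms by (metis ext length_2_iff)

section \<open>Components of cochains in low degrees\<close>

lemma multilinear_maps_1:
  "f \<in> multilinear_maps sA sB (Suc 0) \<longleftrightarrow>
     (\<forall>xs. length xs \<noteq> Suc 0 \<longrightarrow> f xs = 0) \<and> module_hom sA sB (\<lambda>x. f [x])"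
  by (simp add: multilinear_maps_def all_length_1)

lemma multilinear_maps_2:
  "f \<in> multilinear_maps sA sB (Suc (Suc 0)) \<longleftrightarrow>
     (\<forall>xs. length xs \<noteq> Suc (Suc 0) \<longrightarrow> f xs = 0) \<and> bilinear_map sA sA sB (\<lambda>a b. f [a, b])"
  by (auto simp add: multilinear_maps_def bilinear_map_def all_length_2 less_Suc_eq all_conj_distrib)

text \<open>Words in \<open>mixed_words k\<close> have length \<open>k + 1\<close>, so the indices
  0, 1, 2 belong to the M-valued components in degrees 1, 2, 3.\<close>

lemma mixed_words_0: "w \<in> mixed_words 0 \<longleftrightarrow> (\<exists>u. w = [Inr u])"
proof
  assume "w \<in> mixed_words 0"
  then obtain x where "w = [x]" "\<not> isl x"
    by (auto simp: mixed_words_def length_1_iff split: if_splits)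
  then show "\<exists>u. w = [Inr u]"
    by (cases x) auto
qed (auto simp: mixed_words_def)

lemma mixed_words_1:
  "w \<in> mixed_words (Suc 0) \<longleftrightarrow> (\<exists>a u. w = [Inl a, Inr u] \<or> w = [Inr u, Inl a])"
proof
  assume "w \<in> mixed_words (Suc 0)"
  then obtain x y where "w = [x, y]" "length (filter (\<lambda>x. \<not> isl x) [x, y]) = 1"
    by (auto simp: mixed_words_def length_2_iff)
  then show "\<exists>a u. w = [Inl a, Inr u] \<or> w = [Inr u, Inl a]"
    by (cases x; cases y) auto
qed (auto simp: mixed_words_def)

lemma mixed_words_2:
  "w \<in> mixed_words (Suc (Suc 0)) \<longleftrightarrow>
     (\<exists>a b u. w = [Inl a, Inl b, Inr u] \<or> w = [Inl a, Inr u, Inl b] \<or> w = [Inr u, Inl a, Inl b])"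
proof
  assume "w \<in> mixed_words (Suc (Suc 0))"
  then obtain x y z where "w = [x, y, z]" "length (filter (\<lambda>x. \<not> isl x) [x, y, z]) = 1"
    by (auto simp: mixed_words_def length_3_iff)
  then show "\<exists>a b u. w = [Inl a, Inl b, Inr u] \<or> w = [Inl a, Inr u, Inl b] \<or> w = [Inr u, Inl a, Inl b]"
    by (cases x; cases y; cases z) auto
qed (auto simp: mixed_words_def)

lemma eq_iff_mixed_words_1:
  assumes "\<And>w. w \<notin> mixed_words (Suc 0) \<Longrightarrow> F w = G w"
  shows "F = G \<longleftrightarrow> (\<forall>a u. F [Inl a, Inr u] = G [Inl a, Inr u]) \<and>
    (\<forall>u a. F [Inr u, Inl a] = G [Inr u, Inl a])"
  using assms by (metis ext mixed_words_1)

lemma eq_iff_mixed_words_2: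
  assumes "\<And>w. w \<notin> mixed_words (Suc (Suc 0)) \<Longrightarrow> F w = G w"
  shows "F = G \<longleftrightarrow> (\<forall>a b u. F [Inl a, Inl b, Inr u] = G [Inl a, Inl b, Inr u]) \<and>
    (\<forall>a u b. F [Inl a, Inr u, Inl b] = G [Inl a, Inr u, Inl b]) \<and>
    (\<forall>u a b. F [Inr u, Inl a, Inl b] = G [Inr u, Inl a, Inl b])"
  using assms by (metis ext mixed_words_2)

lemma mixed_maps_0:
  "g \<in> mixed_maps sA sM 0 \<longleftrightarrow>
     (\<forall>w. w \<notin> mixed_words 0 \<longrightarrow> g w = 0) \<and> module_hom sM sM (\<lambda>u. g [Inr u])"
proof -
  have "(\<forall>w \<in> mixed_words 0. P w) \<longleftrightarrow> (\<forall>u. P [Inr u])" for P :: "('a + 'b) list \<Rightarrow> bool"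
    by (auto simp: mixed_words_0)
  then show ?thesis
    by (simp add: mixed_maps_def)
qed

text \<open>In degree 2 the letter from M stands either last or first, so a mixed map is an
  independent pair of bilinear maps. They serve as \<open>l1\<close> and \<open>r1\<close>.\<close>

lemma mixed_maps_1:
  "g \<in> mixed_maps sA sM (Suc 0) \<longleftrightarrow>
     (\<forall>w. w \<notin> mixed_words (Suc 0) \<longrightarrow> g w = 0) \<and>
     bilinear_map sA sM sM (\<lambda>a u. g [Inl a, Inr u]) \<and>
     bilinear_map sM sA sM (\<lambda>u a. g [Inr u, Inl a])" (is "_ \<longleftrightarrow> ?Z \<and> ?L \<and> ?R")
proof -
  have "(\<forall>w \<in> mixed_words (Suc 0). \<forall>i \<le> Suc 0. P w i) \<longleftrightarrow>
      (\<forall>a u. P [Inl a, Inr u] 0 \<and> P [Inl a, Inr u] 1 \<and> P [Inr u, Inl a] 0 \<and> P [Inr u, Inl a] 1)"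
    for P :: "('a + 'b) list \<Rightarrow> nat \<Rightarrow> bool"
    by (auto simp: mixed_words_1 le_Suc_eq)
  then show ?thesis
    by (simp add: mixed_maps_def bilinear_map_def) blast
qed

lemma family_maps_1:
  "\<gamma> \<in> family_maps sM sA (Suc 0) \<longleftrightarrow>
     (\<forall>ws us. length ws \<noteq> Suc 0 \<or> length us \<noteq> Suc 0 \<longrightarrow> \<gamma> ws us = 0) \<and>
     (\<forall>\<alpha>. module_hom sM sA (\<lambda>u. \<gamma> [\<alpha>] [u]))"
  by (auto simp: family_maps_def multilinear_maps_1 length_1_iff fun_eq_iff)

lemma cochains_1:
  "(f, g, \<gamma>) \<in> cochains sA sM (Suc 0) \<longleftrightarrow>
     f \<in> multilinear_maps sA sA (Suc 0) \<and> g \<in> mixed_maps sA sM 0 \<and> \<gamma> = 0"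
  by (auto simp: cochains_def)

lemma cochains_2:
  "(f, g, \<gamma>) \<in> cochains sA sM 2 \<longleftrightarrow>
     f \<in> multilinear_maps sA sA (Suc (Suc 0)) \<and> g \<in> mixed_maps sA sM (Suc 0) \<and>
     \<gamma> \<in> family_maps sM sA (Suc 0)"
  by (auto simp: cochains_def numeral_2_eq_2)

lemma cochain_2_eqI:
  assumes "(f, g, \<gamma>) \<in> cochains sA sM 2" "(f', g', \<gamma>') \<in> cochains sA sM 2"
    and "\<And>a b. f [a, b] = f' [a, b]"
    and "\<And>a u. g [Inl a, Inr u] = g' [Inl a, Inr u]"
    and "\<And>a u. g [Inr u, Inl a] = g' [Inr u, Inl a]"
    and "\<And>\<alpha> u. \<gamma> [\<alpha>] [u] = \<gamma>' [\<alpha>] [u]"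
  shows "(f, g, \<gamma>) = (f', g', \<gamma>')"
proof -
  have "f = f'"
    using assms by (subst eq_iff_length_2) (auto simp: cochains_2 multilinear_maps_2)
  moreover have "g = g'"
    using assms by (subst eq_iff_mixed_words_1) (auto simp: cochains_2 mixed_maps_1)
  moreover have "\<gamma> = \<gamma>'"
    using assms by (subst eq_iff_family_1) (auto simp: cochains_2 family_maps_1)
  ultimately show ?thesis
    by simp
qed

section \<open>Deformations and cocycles\<close>

context rRBf_algebra
begin

section \<open>Axioms and morphisms expanded modulo t^2\<close>

lemmas bilinear_simps =
  bilinear_mapD[OF bilinear_mu] bilinear_mapD[OF bilinear_l] bilinear_mapD[OF bilinear_r]
  module_hom.add[OF linear_R] module_hom.zero[OF linear_R]

text \<open>The constant coefficient of each axiom is the axiom of the given algebra. In the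
  coefficient of t, the terms with a t-part of an argument are again instances of the given axioms;
  the terms with a first-order map remain.\<close>

lemma rRBf_algebra_trunc_iff:
  assumes "bilinear_map sA sA sA mu1" "bilinear_map sA sM sM l1" "bilinear_map sM sA sM r1"
    and "\<And>\<alpha>. module_hom sM sA (R1 \<alpha>)"
  shows "rRBf_algebra (trunc_scale sA) (trunc_scale sM) (trunc_bilin mu mu1)
           (trunc_bilin l l1) (trunc_bilin r r1) (\<lambda>\<alpha>. trunc_lin (R \<alpha>) (R1 \<alpha>)) \<longleftrightarrow>
    (\<forall>a b c. mu (mu1 a b) c + mu1 (mu a b) c = mu a (mu1 b c) + mu1 a (mu b c)) \<and>
    (\<forall>a b u. l (mu1 a b) u + l1 (mu a b) u = l a (l1 b u) + l1 a (l b u)) \<and>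
    (\<forall>a u b. r (l1 a u) b + r1 (l a u) b = l a (r1 u b) + l1 a (r u b)) \<and>
    (\<forall>u a b. r (r1 u a) b + r1 (r u a) b = r u (mu1 a b) + r1 u (mu a b)) \<and>
    (\<forall>\<alpha> \<beta> u v. mu (R \<alpha> u) (R1 \<beta> v) + mu (R1 \<alpha> u) (R \<beta> v) + mu1 (R \<alpha> u) (R \<beta> v) =
       R (\<alpha> * \<beta>) (l (R1 \<alpha> u) v + l1 (R \<alpha> u) v + r u (R1 \<beta> v) + r1 u (R \<beta> v))
       + R1 (\<alpha> * \<beta>) (l (R \<alpha> u) v + r u (R \<beta> v)))"
    (is "?L \<longleftrightarrow> ?R")
proof
  note simps = bilinear_simps bilinear_mapD[OF assms(1)] bilinear_mapD[OF assms(2)]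
    bilinear_mapD[OF assms(3)] module_hom.add[OF assms(4)] module_hom.zero[OF assms(4)]
    trunc_bilin_def trunc_lin_def plus_trunc_def
  {
    assume ?L
    then interpret T: rRBf_algebra "trunc_scale sA" "trunc_scale sM" "trunc_bilin mu mu1"
      "trunc_bilin l l1" "trunc_bilin r r1" "\<lambda>\<alpha>. trunc_lin (R \<alpha>) (R1 \<alpha>)" .
    show ?R
      \<comment> \<open>Constant arguments have no t-part, so the t-coefficients are exactly the
        five identities.\<close>
      using T.assoc[of "Tr a 0" "Tr b 0" "Tr c 0" for a b c]
        T.left_action[of "Tr a 0" "Tr b 0" "Tr u 0" for a b u]
        T.bimodule[of "Tr a 0" "Tr u 0" "Tr b 0" for a b u]
        T.right_action[of "Tr u 0" "Tr a 0" "Tr b 0" for a b u]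
        T.rota_baxter[of _ "Tr u 0" _ "Tr v 0" for u v]
      by (simp add: simps algebra_simps)
  }
  assume rhs: ?R
  show ?L
  proof (intro rRBf_algebra.intro rRBf_algebra_axioms.intro)
    show "module (trunc_scale sA)" "module (trunc_scale sM)"
      by (intro module_trunc_scale A.module_axioms M.module_axioms)+
    show "bilinear_map (trunc_scale sA) (trunc_scale sA) (trunc_scale sA) (trunc_bilin mu mu1)"
      by (intro bilinear_trunc_bilin bilinear_mu assms A.module_axioms M.module_axioms)
    show "bilinear_map (trunc_scale sA) (trunc_scale sM) (trunc_scale sM) (trunc_bilin l l1)"
      by (intro bilinear_trunc_bilin bilinear_l assms A.module_axioms M.module_axioms)
    show "bilinear_map (trunc_scale sM) (trunc_scale sA) (trunc_scale sM) (trunc_bilin r r1)"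
      by (intro bilinear_trunc_bilin bilinear_r assms A.module_axioms M.module_axioms)
    show "module_hom (trunc_scale sM) (trunc_scale sA) (trunc_lin (R \<alpha>) (R1 \<alpha>))" for \<alpha>
      by (intro module_hom_trunc_lin linear_R assms)
    show "trunc_bilin mu mu1 (trunc_bilin mu mu1 a b) c =
        trunc_bilin mu mu1 a (trunc_bilin mu mu1 b c)" for a b c
      using rhs by (simp add: simps assoc algebra_simps)
    show "trunc_bilin l l1 (trunc_bilin mu mu1 a b) u =
        trunc_bilin l l1 a (trunc_bilin l l1 b u)" for a b u
      using rhs by (simp add: simps left_action algebra_simps)
    show "trunc_bilin r r1 (trunc_bilin l l1 a u) b =
        trunc_bilin l l1 a (trunc_bilin r r1 u b)" for a b u
      using rhs by (simp add: simps bimodule algebra_simps)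
    show "trunc_bilin r r1 (trunc_bilin r r1 u a) b =
        trunc_bilin r r1 u (trunc_bilin mu mu1 a b)" for a b u
      using rhs by (simp add: simps right_action algebra_simps)
    show "trunc_bilin mu mu1 (trunc_lin (R \<alpha>) (R1 \<alpha>) u) (trunc_lin (R \<beta>) (R1 \<beta>) v) =
        trunc_lin (R (\<alpha> * \<beta>)) (R1 (\<alpha> * \<beta>))
          (trunc_bilin l l1 (trunc_lin (R \<alpha>) (R1 \<alpha>) u) v +
           trunc_bilin r r1 u (trunc_lin (R \<beta>) (R1 \<beta>) v))" for \<alpha> \<beta> u v
      using rhs by (simp add: simps rota_baxter algebra_simps)
  qed
qed

text \<open>The constant coefficients agree, since both structures have the same constant terms and
  the maps start with \<open>id\<close>. The t-parts of the arguments enter both t-coefficients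
  alike and cancel.\<close>

lemma rRBf_morphism_trunc_iff:
  assumes "module_hom sA sA \<phi>" "module_hom sM sM \<psi>"
  shows "rRBf_morphism (trunc_scale sA) (trunc_scale sM)
      (trunc_bilin mu mu1, trunc_bilin l l1, trunc_bilin r r1, \<lambda>\<alpha>. trunc_lin (R \<alpha>) (R1 \<alpha>))
      (trunc_scale sA) (trunc_scale sM)
      (trunc_bilin mu mu1', trunc_bilin l l1', trunc_bilin r r1', \<lambda>\<alpha>. trunc_lin (R \<alpha>) (R1' \<alpha>))
      (trunc_lin id \<phi>) (trunc_lin id \<psi>) \<longleftrightarrow>
    (\<forall>a b. mu1 a b - mu1' a b = mu a (\<phi> b) - \<phi> (mu a b) + mu (\<phi> a) b) \<and>
    (\<forall>a u. l1 a u - l1' a u = l a (\<psi> u) - \<psi> (l a u) + l (\<phi> a) u) \<and>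
    (\<forall>u a. r1 u a - r1' u a = r u (\<phi> a) - \<psi> (r u a) + r (\<psi> u) a) \<and>
    (\<forall>\<alpha> u. R1 \<alpha> u - R1' \<alpha> u = R \<alpha> (\<psi> u) - \<phi> (R \<alpha> u))"
proof -
  note homs = module_hom_trunc_lin[OF A.module_hom_id assms(1)]
    module_hom_trunc_lin[OF M.module_hom_id assms(2)]
  note simps = bilinear_simps module_hom.add[OF assms(1)] module_hom.add[OF assms(2)]
    trunc_bilin_def trunc_lin_def
  have "(\<forall>a b. trunc_lin id \<phi> (trunc_bilin mu mu1 a b) =
        trunc_bilin mu mu1' (trunc_lin id \<phi> a) (trunc_lin id \<phi> b)) \<longleftrightarrow>
      (\<forall>a b. mu1 a b - mu1' a b = mu a (\<phi> b) - \<phi> (mu a b) + mu (\<phi> a) b)"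
  proof (intro iffI allI)
    fix a b
    assume "\<forall>a b. trunc_lin id \<phi> (trunc_bilin mu mu1 a b) =
        trunc_bilin mu mu1' (trunc_lin id \<phi> a) (trunc_lin id \<phi> b)"
    from this[rule_format, of "Tr a 0" "Tr b 0"]
    show "mu1 a b - mu1' a b = mu a (\<phi> b) - \<phi> (mu a b) + mu (\<phi> a) b"
      by (simp add: simps algebra_simps)
  next
    fix a b
    assume "\<forall>a b. mu1 a b - mu1' a b = mu a (\<phi> b) - \<phi> (mu a b) + mu (\<phi> a) b"
    \<comment> \<open>First-order maps see only the constant parts of the arguments.\<close>
    from this[rule_format, of "tr0 a" "tr0 b"]
    show "trunc_lin id \<phi> (trunc_bilin mu mu1 a b) =
        trunc_bilin mu mu1' (trunc_lin id \<phi> a) (trunc_lin id \<phi> b)"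
      by (simp add: simps algebra_simps)
  qed
  moreover have "(\<forall>a u. trunc_lin id \<psi> (trunc_bilin l l1 a u) =
        trunc_bilin l l1' (trunc_lin id \<phi> a) (trunc_lin id \<psi> u)) \<longleftrightarrow>
      (\<forall>a u. l1 a u - l1' a u = l a (\<psi> u) - \<psi> (l a u) + l (\<phi> a) u)"
  proof (intro iffI allI)
    fix a u
    assume "\<forall>a u. trunc_lin id \<psi> (trunc_bilin l l1 a u) =
        trunc_bilin l l1' (trunc_lin id \<phi> a) (trunc_lin id \<psi> u)"
    from this[rule_format, of "Tr a 0" "Tr u 0"]
    show "l1 a u - l1' a u = l a (\<psi> u) - \<psi> (l a u) + l (\<phi> a) u"
      by (simp add: simps algebra_simps)
  next
    fix a u
    assume "\<forall>a u. l1 a u - l1' a u = l a (\<psi> u) - \<psi> (l a u) + l (\<phi> a) u"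
    from this[rule_format, of "tr0 a" "tr0 u"]
    show "trunc_lin id \<psi> (trunc_bilin l l1 a u) =
        trunc_bilin l l1' (trunc_lin id \<phi> a) (trunc_lin id \<psi> u)"
      by (simp add: simps algebra_simps)
  qed
  moreover have "(\<forall>u a. trunc_lin id \<psi> (trunc_bilin r r1 u a) =
        trunc_bilin r r1' (trunc_lin id \<psi> u) (trunc_lin id \<phi> a)) \<longleftrightarrow>
      (\<forall>u a. r1 u a - r1' u a = r u (\<phi> a) - \<psi> (r u a) + r (\<psi> u) a)"
  proof (intro iffI allI)
    fix u a
    assume "\<forall>u a. trunc_lin id \<psi> (trunc_bilin r r1 u a) =
        trunc_bilin r r1' (trunc_lin id \<psi> u) (trunc_lin id \<phi> a)"
    from this[rule_format, of "Tr u 0" "Tr a 0"]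
    show "r1 u a - r1' u a = r u (\<phi> a) - \<psi> (r u a) + r (\<psi> u) a"
      by (simp add: simps algebra_simps)
  next
    fix u a
    assume "\<forall>u a. r1 u a - r1' u a = r u (\<phi> a) - \<psi> (r u a) + r (\<psi> u) a"
    from this[rule_format, of "tr0 u" "tr0 a"]
    show "trunc_lin id \<psi> (trunc_bilin r r1 u a) =
        trunc_bilin r r1' (trunc_lin id \<psi> u) (trunc_lin id \<phi> a)"
      by (simp add: simps algebra_simps)
  qed
  moreover have "(\<forall>\<alpha>. trunc_lin id \<phi> \<circ> trunc_lin (R \<alpha>) (R1 \<alpha>) =
        trunc_lin (R \<alpha>) (R1' \<alpha>) \<circ> trunc_lin id \<psi>) \<longleftrightarrow>
      (\<forall>\<alpha> u. R1 \<alpha> u - R1' \<alpha> u = R \<alpha> (\<psi> u) - \<phi> (R \<alpha> u))"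
  proof (intro iffI allI ext)
    fix \<alpha> u
    assume "\<forall>\<alpha>. trunc_lin id \<phi> \<circ> trunc_lin (R \<alpha>) (R1 \<alpha>) =
        trunc_lin (R \<alpha>) (R1' \<alpha>) \<circ> trunc_lin id \<psi>"
    from fun_cong[OF this[rule_format], of \<alpha> "Tr u 0"]
    show "R1 \<alpha> u - R1' \<alpha> u = R \<alpha> (\<psi> u) - \<phi> (R \<alpha> u)"
      by (simp add: simps algebra_simps)
  next
    fix \<alpha> u
    assume "\<forall>\<alpha> u. R1 \<alpha> u - R1' \<alpha> u = R \<alpha> (\<psi> u) - \<phi> (R \<alpha> u)"
    from this[rule_format, of \<alpha> "tr0 u"]
    show "(trunc_lin id \<phi> \<circ> trunc_lin (R \<alpha>) (R1 \<alpha>)) u =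
        (trunc_lin (R \<alpha>) (R1' \<alpha>) \<circ> trunc_lin id \<psi>) u"
      by (simp add: simps algebra_simps)
  qed
  ultimately show ?thesis
    using homs by (simp add: rRBf_morphism_def)
qed

section \<open>Structures modulo t^2 from 2-cochains\<close>

definition deformation_of_cochain :: "('a, 'm, 'w) cochain \<Rightarrow> ('a, 'm, 'w) trunc_structure" where
  "deformation_of_cochain = (\<lambda>(f, g, \<gamma>).
     (trunc_bilin mu (\<lambda>a b. f [a, b]),
      trunc_bilin l (\<lambda>a u. g [Inl a, Inr u]),
      trunc_bilin r (\<lambda>u a. g [Inr u, Inl a]),
      \<lambda>\<alpha>. trunc_lin (R \<alpha>) (\<lambda>u. \<gamma> [\<alpha>] [u])))"

text \<open>The structure determines its first-order maps, and these contain all values of a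
  2-cochain on tensors.\<close>

lemma inj_on_deformation_of_cochain: "inj_on deformation_of_cochain (cochains sA sM 2)"
proof (rule inj_onI)
  fix c d
  assume cd: "c \<in> cochains sA sM 2" "d \<in> cochains sA sM 2"
    and eq: "deformation_of_cochain c = deformation_of_cochain d"
  obtain f g \<gamma> where c: "c = (f, g, \<gamma>)"
    by (cases c)
  obtain f' g' \<gamma>' where d: "d = (f', g', \<gamma>')"
    by (cases d)
  have "(\<lambda>a b. f [a, b]) = (\<lambda>a b. f' [a, b])"
    "(\<lambda>a u. g [Inl a, Inr u]) = (\<lambda>a u. g' [Inl a, Inr u])"
    "(\<lambda>u a. g [Inr u, Inl a]) = (\<lambda>u a. g' [Inr u, Inl a])"
    "(\<lambda>\<alpha> u. \<gamma> [\<alpha>] [u]) = (\<lambda>\<alpha> u. \<gamma>' [\<alpha>] [u])"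
    using eq by (simp_all add: deformation_of_cochain_def c d)
  then show "c = d"
    using cd unfolding c d by (intro cochain_2_eqI) (auto dest: fun_cong)
qed

section \<open>The 2-cocycle condition written out\<close>

text \<open>The terms with a minus sign are moved to the other side, which gives the t-coefficient
  of associativity as in \<open>rRBf_algebra_trunc_iff\<close>.\<close>

lemma delta_Hoch_2_eq_0_iff:
  "delta_Hoch sA mu 2 f = 0 \<longleftrightarrow>
     (\<forall>a b c. mu (f [a, b]) c + f [mu a b, c] = mu a (f [b, c]) + f [a, mu b c])"
proof -
  have "delta_Hoch sA mu 2 f = 0 \<longleftrightarrow> (\<forall>a b c. delta_Hoch sA mu 2 f [a, b, c] = 0)"
    by (subst eq_iff_length_3) (auto simp: delta_Hoch_def)
  also have "\<dots> \<longleftrightarrow> (\<forall>a b c. mu a (f [b, c]) - f [mu a b, c] + f [a, mu b c] - mu (f [a, b]) c = 0)"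
    by (simp add: delta_Hoch_def contract_def numeral_2_eq_2 algebra_simps)
  finally show ?thesis
    by (simp add: algebra_simps eq_diff_eq diff_eq_eq) metis
qed

text \<open>The three positions of the letter from M give the left action, bimodule and right action
  axioms, in this order. \<open>f\<close> enters only where both letters from A remain after
  removing an end of the word, so not in the middle case.\<close>

lemma delta_mixed_2_eq_0_iff:
  "delta_mixed sM mu l r 2 f g = 0 \<longleftrightarrow>
    (\<forall>a b u. l (f [a, b]) u + g [Inl (mu a b), Inr u] =
       l a (g [Inl b, Inr u]) + g [Inl a, Inr (l b u)]) \<and>
    (\<forall>a u b. r (g [Inl a, Inr u]) b + g [Inr (l a u), Inl b] =
       l a (g [Inr u, Inl b]) + g [Inl a, Inr (r u b)]) \<and>
    (\<forall>u a b. r (g [Inr u, Inl a]) b + g [Inr (r u a), Inl b] =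
       r u (f [a, b]) + g [Inr u, Inl (mu a b)])"
proof -
  let ?D = "delta_mixed sM mu l r 2 f g"
  have "?D = 0 \<longleftrightarrow> (\<forall>a b u. ?D [Inl a, Inl b, Inr u] = 0) \<and> (\<forall>a u b. ?D [Inl a, Inr u, Inl b] = 0)
      \<and> (\<forall>u a b. ?D [Inr u, Inl a, Inl b] = 0)"
    by (subst eq_iff_mixed_words_2) (auto simp: delta_mixed_def numeral_2_eq_2)
  moreover have "?D [Inl a, Inl b, Inr u] = l a (g [Inl b, Inr u]) - g [Inl (mu a b), Inr u]
      + g [Inl a, Inr (l b u)] - l (f [a, b]) u" for a b u
    by (simp add: delta_mixed_def contract_def numeral_2_eq_2 mixed_words_2 mixed_eval_def)
  moreover have "?D [Inl a, Inr u, Inl b] = l a (g [Inr u, Inl b]) - g [Inr (l a u), Inl b]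
      + g [Inl a, Inr (r u b)] - r (g [Inl a, Inr u]) b" for a b u
    by (simp add: delta_mixed_def contract_def numeral_2_eq_2 mixed_words_2 mixed_eval_def)
  moreover have "?D [Inr u, Inl a, Inl b] = r u (f [a, b]) - g [Inr (r u a), Inl b]
      + g [Inr u, Inl (mu a b)] - r (g [Inr u, Inl a]) b" for a b u
    by (simp add: delta_mixed_def contract_def numeral_2_eq_2 mixed_words_2 mixed_eval_def)
  ultimately show ?thesis
    by (simp add: algebra_simps eq_diff_eq diff_eq_eq) metis
qed

text \<open>\<open>\<gamma>\<close> has one argument in degree 2, so \<open>delta_R\<close> takes
  index 1 but \<open>h_R\<close> takes 2, with sign +1. Linearity of \<open>R\<close> collects two
  terms from each into one value of \<open>R (\<alpha> * \<beta>)\<close>.\<close>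

lemma delta_R_1_plus_h_R_2_eq_0_iff:
  "delta_R sA mu l r R 1 \<gamma> + h_R sA R 2 f g = 0 \<longleftrightarrow>
    (\<forall>\<alpha> \<beta> u v. mu (R \<alpha> u) (\<gamma> [\<beta>] [v]) + mu (\<gamma> [\<alpha>] [u]) (R \<beta> v) + f [R \<alpha> u, R \<beta> v] =
       R (\<alpha> * \<beta>) (l (\<gamma> [\<alpha>] [u]) v + g [Inl (R \<alpha> u), Inr v] + r u (\<gamma> [\<beta>] [v])
         + g [Inr u, Inl (R \<beta> v)])
       + \<gamma> [\<alpha> * \<beta>] [l (R \<alpha> u) v + r u (R \<beta> v)])"
proof -
  let ?D = "delta_R sA mu l r R 1 \<gamma> + h_R sA R 2 f g"
  have "?D = 0 \<longleftrightarrow> (\<forall>\<alpha> \<beta> u v. ?D [\<alpha>, \<beta>] [u, v] = 0)"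
    by (subst eq_iff_family_2) (auto simp: delta_R_def h_R_def)
  moreover have "?D [\<alpha>, \<beta>] [u, v] =
      mu (R \<alpha> u) (\<gamma> [\<beta>] [v]) + mu (\<gamma> [\<alpha>] [u]) (R \<beta> v) + f [R \<alpha> u, R \<beta> v]
      - (R (\<alpha> * \<beta>) (l (\<gamma> [\<alpha>] [u]) v + g [Inl (R \<alpha> u), Inr v] + r u (\<gamma> [\<beta>] [v])
         + g [Inr u, Inl (R \<beta> v)])
       + \<gamma> [\<alpha> * \<beta>] [l (R \<alpha> u) v + r u (R \<beta> v)])" for \<alpha> \<beta> u v
    by (simp add: delta_R_def h_R_def contract_def numeral_2_eq_2 sg_prod_def bilinear_simps
        algebra_simps)
  ultimately show ?thesis
    by simp
qed

section \<open>Cocycles and deformations\<close>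

lemma deformation_of_cochain_in_iff:
  assumes "c \<in> cochains sA sM 2"
  shows "deformation_of_cochain c \<in> infinitesimal_deformations sA sM mu l r R \<longleftrightarrow>
    differential sA sM mu l r R 2 c = 0"
proof -
  obtain f g \<gamma> where c: "c = (f, g, \<gamma>)"
    by (cases c)
  have lin: "bilinear_map sA sA sA (\<lambda>a b. f [a, b])" "bilinear_map sA sM sM (\<lambda>a u. g [Inl a, Inr u])"
    "bilinear_map sM sA sM (\<lambda>u a. g [Inr u, Inl a])" "\<And>\<alpha>. module_hom sM sA (\<lambda>u. \<gamma> [\<alpha>] [u])"
    using assms by (auto simp: c cochains_2 multilinear_maps_2 mixed_maps_1 family_maps_1)
  have "differential sA sM mu l r R 2 c = 0 \<longleftrightarrow> delta_Hoch sA mu 2 f = 0 \<and>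
      delta_mixed sM mu l r 2 f g = 0 \<and> delta_R sA mu l r R 1 \<gamma> + h_R sA R 2 f g = 0"
    by (simp add: differential_def c zero_prod_def)
  also have "\<dots> \<longleftrightarrow> rRBf_algebra (trunc_scale sA) (trunc_scale sM)
      (trunc_bilin mu (\<lambda>a b. f [a, b])) (trunc_bilin l (\<lambda>a u. g [Inl a, Inr u]))
      (trunc_bilin r (\<lambda>u a. g [Inr u, Inl a])) (\<lambda>\<alpha>. trunc_lin (R \<alpha>) (\<lambda>u. \<gamma> [\<alpha>] [u]))"
    unfolding rRBf_algebra_trunc_iff[OF lin] delta_Hoch_2_eq_0_iff delta_mixed_2_eq_0_iff
      delta_R_1_plus_h_R_2_eq_0_iff by blast
  \<comment> \<open>The first-order maps required by membership are forced to be those of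
    \<open>c\<close>, which are linear by \<open>lin\<close>; only the axioms remain.\<close>
  also have "\<dots> \<longleftrightarrow> deformation_of_cochain c \<in> infinitesimal_deformations sA sM mu l r R"
    using lin by (auto simp: infinitesimal_deformations_def deformation_of_cochain_def c)
  finally show ?thesis ..
qed

lemma infinitesimal_deformation_of_cochain:
  assumes "D \<in> infinitesimal_deformations sA sM mu l r R"
  obtains c where "c \<in> cochains sA sM 2" "D = deformation_of_cochain c"
proof -
  obtain mu1 l1 r1 R1 where
    lin: "bilinear_map sA sA sA mu1" "bilinear_map sA sM sM l1" "bilinear_map sM sA sM r1"
      "\<And>\<alpha>. module_hom sM sA (R1 \<alpha>)"
    and D: "D = (trunc_bilin mu mu1, trunc_bilin l l1, trunc_bilin r r1,
      \<lambda>\<alpha>. trunc_lin (R \<alpha>) (R1 \<alpha>))"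
    using assms by (auto simp: infinitesimal_deformations_def)
  \<comment> \<open>The first-order maps are extended by 0 to lists of the wrong shape, as cochains
    demand.\<close>
  define f where "f = (\<lambda>xs. case xs of [a, b] \<Rightarrow> mu1 a b | _ \<Rightarrow> 0)"
  define g where "g = (\<lambda>w. case w of [Inl a, Inr u] \<Rightarrow> l1 a u | [Inr u, Inl a] \<Rightarrow> r1 u a | _ \<Rightarrow> 0)"
  define \<gamma> where "\<gamma> = (\<lambda>ws us. case ws of [\<alpha>] \<Rightarrow> (case us of [u] \<Rightarrow> R1 \<alpha> u | _ \<Rightarrow> 0) | _ \<Rightarrow> 0)"
  have "f \<in> multilinear_maps sA sA (Suc (Suc 0))"
    using lin by (auto simp: multilinear_maps_2 f_def split: list.splits)
  moreover have "g \<in> mixed_maps sA sM (Suc 0)"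
    using lin by (auto simp: mixed_maps_1 mixed_words_1 g_def split: list.splits sum.splits)
  moreover have "\<gamma> \<in> family_maps sM sA (Suc 0)"
    using lin by (auto simp: family_maps_1 \<gamma>_def split: list.splits)
  ultimately have "(f, g, \<gamma>) \<in> cochains sA sM 2"
    by (simp add: cochains_2)
  moreover have "D = deformation_of_cochain (f, g, \<gamma>)"
    by (simp add: D deformation_of_cochain_def f_def g_def \<gamma>_def)
  ultimately show ?thesis
    by (rule that)
qed

text \<open>Among 2-cochains, the cocycles are exactly the preimage of the deformations, and every
  deformation comes from a 2-cochain.\<close>

lemma bij_betw_cocycles_deformations:
  "bij_betw deformation_of_cochain (cocycles sA sM mu l r R 2)
     (infinitesimal_deformations sA sM mu l r R)"
proof -
  have "inj_on deformation_of_cochain (cocycles sA sM mu l r R 2)"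
    by (rule inj_on_subset[OF inj_on_deformation_of_cochain]) (auto simp: cocycles_def)
  moreover have "deformation_of_cochain ` cocycles sA sM mu l r R 2 =
      infinitesimal_deformations sA sM mu l r R"
  proof
    show "deformation_of_cochain ` cocycles sA sM mu l r R 2 \<subseteq>
        infinitesimal_deformations sA sM mu l r R"
      using deformation_of_cochain_in_iff by (auto simp: cocycles_def)
    show "infinitesimal_deformations sA sM mu l r R \<subseteq>
        deformation_of_cochain ` cocycles sA sM mu l r R 2"
    proof
      fix D
      assume D: "D \<in> infinitesimal_deformations sA sM mu l r R"
      then obtain c where c: "c \<in> cochains sA sM 2" "D = deformation_of_cochain c"
        by (rule infinitesimal_deformation_of_cochain)
      with D have "c \<in> cocycles sA sM mu l r R 2"
        by (simp add: cocycles_def deformation_of_cochain_in_iff)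
      with c show "D \<in> deformation_of_cochain ` cocycles sA sM mu l r R 2"
        by blast
    qed
  qed
  ultimately show ?thesis
    by (simp add: bij_betw_def)
qed

section \<open>Coboundaries and equivalences\<close>

text \<open>The right-hand sides are those of \<open>rRBf_morphism_trunc_iff\<close>, with
  \<open>p\<close> and \<open>q\<close> read on one-letter words. In the last one, the sign (-1)^1
  of \<open>h_R\<close> puts the term with \<open>R\<close> outside first.\<close>

lemma differential_1_eq_iff:
  assumes "(f, g, \<gamma>) \<in> cochains sA sM 2" "(f', g', \<gamma>') \<in> cochains sA sM 2"
  shows "(f, g, \<gamma>) - (f', g', \<gamma>') = differential sA sM mu l r R 1 (p, q, 0) \<longleftrightarrow>
    (\<forall>a b. f [a, b] - f' [a, b] = mu a (p [b]) - p [mu a b] + mu (p [a]) b) \<and>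
    (\<forall>a u. g [Inl a, Inr u] - g' [Inl a, Inr u] =
       l a (q [Inr u]) - q [Inr (l a u)] + l (p [a]) u) \<and>
    (\<forall>u a. g [Inr u, Inl a] - g' [Inr u, Inl a] =
       r u (p [a]) - q [Inr (r u a)] + r (q [Inr u]) a) \<and>
    (\<forall>\<alpha> u. \<gamma> [\<alpha>] [u] - \<gamma>' [\<alpha>] [u] = R \<alpha> (q [Inr u]) - p [R \<alpha> u])"
proof -
  have f: "f xs = 0" "f' xs = 0" if "length xs \<noteq> Suc (Suc 0)" for xs
    using assms that by (auto simp: cochains_2 multilinear_maps_2)
  have g: "g w = 0" "g' w = 0" if "w \<notin> mixed_words (Suc 0)" for w
    using assms that by (auto simp: cochains_2 mixed_maps_1)
  have \<gamma>: "\<gamma> ws us = 0" "\<gamma>' ws us = 0" if "length ws \<noteq> Suc 0 \<or> length us \<noteq> Suc 0" for ws us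
    using assms that by (auto simp: cochains_2 family_maps_1)
  have "f - f' = delta_Hoch sA mu 1 p \<longleftrightarrow>
      (\<forall>a b. f [a, b] - f' [a, b] = delta_Hoch sA mu 1 p [a, b])"
    using f by (subst eq_iff_length_2) (auto simp: delta_Hoch_def)
  moreover have "g - g' = delta_mixed sM mu l r 1 p q \<longleftrightarrow>
      (\<forall>a u. g [Inl a, Inr u] - g' [Inl a, Inr u] = delta_mixed sM mu l r 1 p q [Inl a, Inr u]) \<and>
      (\<forall>u a. g [Inr u, Inl a] - g' [Inr u, Inl a] = delta_mixed sM mu l r 1 p q [Inr u, Inl a])"
    using g by (subst eq_iff_mixed_words_1) (auto simp: delta_mixed_def)
  moreover have "\<gamma> - \<gamma>' = h_R sA R 1 p q \<longleftrightarrow>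
      (\<forall>\<alpha> u. \<gamma> [\<alpha>] [u] - \<gamma>' [\<alpha>] [u] = h_R sA R 1 p q [\<alpha>] [u])"
    using \<gamma> by (subst eq_iff_family_1) (auto simp: h_R_def)
  ultimately show ?thesis
    by (simp add: differential_def delta_Hoch_def delta_mixed_def h_R_def contract_def
        mixed_words_1 mixed_eval_def sg_prod_def)
qed

text \<open>A morphism from the deformation of \<open>c\<close> to that of \<open>d\<close>
  expresses the first-order terms of \<open>c\<close> minus those of \<open>d\<close>, so its
  direction fits \<open>c - d\<close>.\<close>

lemma coboundary_iff_deformation_equiv:
  assumes "c \<in> cocycles sA sM mu l r R 2" "d \<in> cocycles sA sM mu l r R 2"
  shows "c - d \<in> coboundaries sA sM mu l r R 2 \<longleftrightarrow>
    (deformation_of_cochain c, deformation_of_cochain d) \<in> deformation_equiv sA sM mu l r R"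
proof -
  obtain f g \<gamma> where c: "c = (f, g, \<gamma>)"
    by (cases c)
  obtain f' g' \<gamma>' where d: "d = (f', g', \<gamma>')"
    by (cases d)
  have cd: "(f, g, \<gamma>) \<in> cochains sA sM 2" "(f', g', \<gamma>') \<in> cochains sA sM 2"
    using assms by (auto simp: cocycles_def c d)
  let ?eqs = "\<lambda>\<phi> \<psi>.
    (\<forall>a b. f [a, b] - f' [a, b] = mu a (\<phi> b) - \<phi> (mu a b) + mu (\<phi> a) b) \<and>
    (\<forall>a u. g [Inl a, Inr u] - g' [Inl a, Inr u] = l a (\<psi> u) - \<psi> (l a u) + l (\<phi> a) u) \<and>
    (\<forall>u a. g [Inr u, Inl a] - g' [Inr u, Inl a] = r u (\<phi> a) - \<psi> (r u a) + r (\<psi> u) a) \<and>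
    (\<forall>\<alpha> u. \<gamma> [\<alpha>] [u] - \<gamma>' [\<alpha>] [u] = R \<alpha> (\<psi> u) - \<phi> (R \<alpha> u))"
  \<comment> \<open>The third component of a 1-cochain is 0, so only \<open>p\<close> and
    \<open>q\<close> vary.\<close>
  have "c - d \<in> coboundaries sA sM mu l r R 2 \<longleftrightarrow>
      (\<exists>p q. p \<in> multilinear_maps sA sA (Suc 0) \<and> q \<in> mixed_maps sA sM 0 \<and>
         c - d = differential sA sM mu l r R 1 (p, q, 0))"
    by (force simp: coboundaries_def cochains_1)
  also have "\<dots> \<longleftrightarrow> (\<exists>p q. p \<in> multilinear_maps sA sA (Suc 0) \<and> q \<in> mixed_maps sA sM 0 \<and>
         ?eqs (\<lambda>a. p [a]) (\<lambda>u. q [Inr u]))"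
    unfolding c d differential_1_eq_iff[OF cd] by simp
  also have "\<dots> \<longleftrightarrow> (\<exists>\<phi> \<psi>. module_hom sA sA \<phi> \<and> module_hom sM sM \<psi> \<and> ?eqs \<phi> \<psi>)"
  proof
    assume "\<exists>p q. p \<in> multilinear_maps sA sA (Suc 0) \<and> q \<in> mixed_maps sA sM 0 \<and>
         ?eqs (\<lambda>a. p [a]) (\<lambda>u. q [Inr u])"
    then obtain p q where "p \<in> multilinear_maps sA sA (Suc 0) \<and> q \<in> mixed_maps sA sM 0 \<and>
         ?eqs (\<lambda>a. p [a]) (\<lambda>u. q [Inr u])"
      by (elim exE) (rule that)
    then show "\<exists>\<phi> \<psi>. module_hom sA sA \<phi> \<and> module_hom sM sM \<psi> \<and> ?eqs \<phi> \<psi>"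
      by (intro exI[of _ "\<lambda>a. p [a]"] exI[of _ "\<lambda>u. q [Inr u]"])
        (simp add: multilinear_maps_1 mixed_maps_0)
  next
    assume "\<exists>\<phi> \<psi>. module_hom sA sA \<phi> \<and> module_hom sM sM \<psi> \<and> ?eqs \<phi> \<psi>"
    then obtain \<phi> \<psi> where hom: "module_hom sA sA \<phi>" "module_hom sM sM \<psi>" and eqs: "?eqs \<phi> \<psi>"
      by blast
    \<comment> \<open>Extension by 0 off the one-letter words of the right kind turns the linear
      maps into a 1-cochain.\<close>
    define p where "p = (\<lambda>xs. case xs of [a] \<Rightarrow> \<phi> a | _ \<Rightarrow> 0)"
    define q :: "('a + 'm) list \<Rightarrow> 'm" where
      "q = (\<lambda>w. case w of [Inr u] \<Rightarrow> \<psi> u | _ \<Rightarrow> 0)"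
    have "p \<in> multilinear_maps sA sA (Suc 0)" "q \<in> mixed_maps sA sM 0"
      using hom by (auto simp: multilinear_maps_1 mixed_maps_0 mixed_words_0 p_def q_def
          split: list.splits sum.splits)
    moreover have "?eqs (\<lambda>a. p [a]) (\<lambda>u. q [Inr u])"
      using eqs by (simp add: p_def q_def)
    ultimately show "\<exists>p q. p \<in> multilinear_maps sA sA (Suc 0) \<and> q \<in> mixed_maps sA sM 0 \<and>
         ?eqs (\<lambda>a. p [a]) (\<lambda>u. q [Inr u])"
      by blast
  qed
  also have "\<dots> \<longleftrightarrow>
      (deformation_of_cochain c, deformation_of_cochain d) \<in> deformation_equiv sA sM mu l r R"
    \<comment> \<open>Both cocycles give deformations, so only a morphism is asked for.
      \<open>conj_cong\<close> supplies the linearity that \<open>rRBf_morphism_trunc_iff\<close>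
      assumes.\<close>
    using assms bij_betw_apply[OF bij_betw_cocycles_deformations]
    by (auto simp: deformation_equiv_def deformation_of_cochain_def c d
        rRBf_morphism_trunc_iff cong: conj_cong)
  finally show ?thesis .
qed

section \<open>Passage to classes\<close>

lemma bij_betw_cohomology_2:
  "bij_betw ((`) deformation_of_cochain) (cohomology sA sM mu l r R 2)
     (infinitesimal_deformations sA sM mu l r R // deformation_equiv sA sM mu l r R)"
  unfolding cohomology_def
  by (rule bij_betw_quotient[OF bij_betw_cocycles_deformations])
    (auto simp: coboundary_iff_deformation_equiv deformation_equiv_def)

end

theorem theorem5p5:
  fixes sA :: "'k::field_char_0 \<Rightarrow> 'a::ab_group_add \<Rightarrow> 'a"
    and sM :: "'k \<Rightarrow> 'm::ab_group_add \<Rightarrow> 'm"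
    and mu :: "'a \<Rightarrow> 'a \<Rightarrow> 'a"
    and l :: "'a \<Rightarrow> 'm \<Rightarrow> 'm"
    and r :: "'m \<Rightarrow> 'a \<Rightarrow> 'm"
    and R :: "'w::semigroup_mult \<Rightarrow> 'm \<Rightarrow> 'a"
  assumes "rRBf_algebra sA sM mu l r R"
  shows "\<exists>F. bij_betw F
           (infinitesimal_deformations sA sM mu l r R // deformation_equiv sA sM mu l r R)
           (cohomology sA sM mu l r R 2)"
  \<comment> \<open>The bijection was built from cohomology to deformation classes; its inverse has
    the stated direction.\<close>
  using bij_betw_inv[OF rRBf_algebra.bij_betw_cohomology_2[OF assms]] .

end
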